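(* Let $G$ be a finite group. Then $\mathcal{P}_E^*(G)$ is regular if and only if one of the following holds: (i) $G$ is a cyclic group; (ii) for any two distinct maximal cyclic subgroups $M_i, M_j\in\mathcal{M}(G)$ one has $|M_i|=|M_j|$ and $M_i\cap M_j=\{e\}$.
   Context: For a finite group $G$ with identity $e$, the enhanced power graph $\mathcal{P}_E(G)$ is the simple undirected graph with vertex set $G$ in which two distinct vertices $x,y$ are adjacent if and only if $x,y\in\langle z\rangle$ for some $z\in G$. The proper enhanced power graph $\mathcal{P}_E^*(G)$ is the subgraph of $\mathcal{P}_E(G)$ induced by $G\setminus\{e\}$. A maximal cyclic subgroup of $G$ is a cyclic subgroup not properly contained in any cyclic subgroup of $G$; $\mathcal{M}(G)$ denotes the set of all maximal cyclic subgroups of $G$. A graph is regular if all its vertices have the same degree. *)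

theory Defs
  imports "HOL-Algebra.Elementary_Groups" "Graph_Theory.Pair_Digraph"
    "Graph_Theory.Digraph_Component"
begin

text \<open>An undirected simple graph is represented, as in \<^locale>\<open>graph\<close>, by a symmetric loop-free
  digraph: an edge joining \<open>x\<close> and \<open>y\<close> is the pair of arcs \<open>(x, y)\<close>, \<open>(y, x)\<close>.\<close>

definition enhanced_power_graph :: "('a, 'b) monoid_scheme \<Rightarrow> 'a pair_pre_digraph" where
  "enhanced_power_graph G =
     \<lparr> pverts = carrier G,
       parcs = {(x, y). x \<in> carrier G \<and> y \<in> carrier G \<and> x \<noteq> y \<and>
                  (\<exists>z \<in> carrier G. x \<in> generate G {z} \<and> y \<in> generate G {z})} \<rparr>"

definition proper_enhanced_power_graph ::
    "('a, 'b) monoid_scheme \<Rightarrow> ('a, 'a \<times> 'a) pre_digraph" where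
  "proper_enhanced_power_graph G =
     with_proj (enhanced_power_graph G) \<restriction> (carrier G - {\<one>\<^bsub>G\<^esub>})"

text \<open>In the digraph representing a simple graph, the arcs leaving \<open>v\<close> correspond to the edges
  at \<open>v\<close>, so the degree of \<open>v\<close> is its out-degree. The definition is meant for such digraphs only.
  The null graph is regular.\<close>

definition regular_graph :: "('v, 'e) pre_digraph \<Rightarrow> bool" where
  "regular_graph H \<longleftrightarrow> (\<forall>u \<in> verts H. \<forall>v \<in> verts H. out_degree H u = out_degree H v)"

definition cyclic_subgroup :: "'a set \<Rightarrow> ('a, 'b) monoid_scheme \<Rightarrow> bool" where
  "cyclic_subgroup M G \<longleftrightarrow> subgroup M G \<and> cyclic_group (G\<lparr>carrier := M\<rparr>)"

definition maximal_cyclic_subgroups :: "('a, 'b) monoid_scheme \<Rightarrow> 'a set set" where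
  "maximal_cyclic_subgroups G =
     {M. cyclic_subgroup M G \<and> \<not> (\<exists>N. cyclic_subgroup N G \<and> M \<subset> N)}"

lemma graph_proper_enhanced_power_graph:
  assumes "finite (carrier G)"
  shows "graph (proper_enhanced_power_graph G)"
proof -
  have "finite (parcs (enhanced_power_graph G))"
    by (rule finite_subset[of _ "carrier G \<times> carrier G"])
      (use assms in \<open>auto simp: enhanced_power_graph_def\<close>)
  then show ?thesis
    using assms
    by unfold_locales
      (auto simp: proper_enhanced_power_graph_def enhanced_power_graph_def symmetric_conv
        arc_to_ends_def)
qed

lemma out_degree_graph:
  assumes "graph H"
  shows "out_degree H v = card {u \<in> verts H. v \<rightarrow>\<^bsub>H\<^esub> u}"
proof -
  interpret graph H by (rule assms)
  have "inj_on (head H) (out_arcs H v)"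
    by (rule inj_onI) (auto intro!: no_multi_arcs simp: arc_to_ends_def)
  moreover have "head H ` out_arcs H v = {u \<in> verts H. v \<rightarrow>\<^bsub>H\<^esub> u}"
    by (auto simp: arcs_ends_conv image_iff)
  ultimately show ?thesis
    unfolding out_degree_def by (metis card_image)
qed

lemma (in group) cyclic_subgroup_iff:
  "cyclic_subgroup M G \<longleftrightarrow> (\<exists>x \<in> carrier G. M = generate G {x})"
proof
  assume "cyclic_subgroup M G"
  then obtain x where M: "subgroup M G" and x: "x \<in> M"
    and eq: "subgroup_generated (G\<lparr>carrier := M\<rparr>) {x} = G\<lparr>carrier := M\<rparr>"
    by (auto simp: cyclic_subgroup_def cyclic_group_def)
  have "M = generate (G\<lparr>carrier := M\<rparr>) {x}"
    using arg_cong[OF eq, of carrier] x by (simp add: carrier_subgroup_generated)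
  also have "\<dots> = generate G {x}"
    using generate_consistent[OF _ M] x by simp
  finally show "\<exists>x \<in> carrier G. M = generate G {x}"
    using subgroup.mem_carrier[OF M x] by blast
next
  assume "\<exists>x \<in> carrier G. M = generate G {x}"
  then obtain x where x: "x \<in> carrier G" and M: "M = generate G {x}" by blast
  have "G\<lparr>carrier := M\<rparr> = subgroup_generated G {x}"
    using x M by (simp add: subgroup_generated_def)
  then show "cyclic_subgroup M G"
    using x M cyclic_group_generated[of x] generate_is_subgroup[of "{x}"]
    by (simp add: cyclic_subgroup_def)
qed

end

theory Submission
  imports Defs
begin

text \<open>
  Two elements are adjacent when some cyclic subgroup contains both, and in a finite group every
  cyclic subgroup lies in a maximal one. So the closed neighbourhood of \<open>x\<close>, taken with the
  identity, is the union \<open>U x\<close> of the maximal cyclic subgroups through \<open>x\<close>, and the degree of a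
  non-identity \<open>x\<close> is \<open>|U x| - 2\<close> (\<open>out_degree_proper_enhanced_power_graph\<close>). Regularity therefore
  says that \<open>|U x|\<close> is the same for all \<open>x \<noteq> \<one>\<close>.

  A generator \<open>m\<close> of a maximal cyclic subgroup \<open>M\<close> lies in no other one, so \<open>U m = M\<close>. Hence
  regularity forces all maximal cyclic subgroups to have a common size. If two different ones shared
  some \<open>x \<noteq> \<one>\<close>, then \<open>U x\<close> would contain both and be larger than either, against regularity.
  Conversely, if the maximal cyclic subgroups pairwise meet trivially, then for \<open>x \<noteq> \<one>\<close> the set \<open>U x\<close>
  is the unique maximal cyclic subgroup through \<open>x\<close>, and equal sizes give equal degrees.

  So regularity amounts to the condition on pairs of maximal cyclic subgroups. A cyclic group
  satisfies that condition vacuously, because its only maximal cyclic subgroup is the whole group.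
\<close>

lemma verts_proper_enhanced_power_graph:
  "verts (proper_enhanced_power_graph G) = carrier G - {\<one>\<^bsub>G\<^esub>}"
  by (auto simp: proper_enhanced_power_graph_def enhanced_power_graph_def)

lemma dominates_proper_enhanced_power_graph_iff:
  "x \<rightarrow>\<^bsub>proper_enhanced_power_graph G\<^esub> y \<longleftrightarrow>
     x \<in> carrier G - {\<one>\<^bsub>G\<^esub>} \<and> y \<in> carrier G - {\<one>\<^bsub>G\<^esub>} \<and> x \<noteq> y \<and>
     (\<exists>z \<in> carrier G. x \<in> generate G {z} \<and> y \<in> generate G {z})"
  by (auto simp: proper_enhanced_power_graph_def enhanced_power_graph_def arcs_ends_conv
      image_iff)

context group
begin

lemma maximal_cyclic_subgroup_subset_carrier:
  "M \<in> maximal_cyclic_subgroups G \<Longrightarrow> M \<subseteq> carrier G"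
  by (auto simp: maximal_cyclic_subgroups_def cyclic_subgroup_def dest: subgroup.mem_carrier)

lemma one_in_maximal_cyclic_subgroup:
  "M \<in> maximal_cyclic_subgroups G \<Longrightarrow> \<one> \<in> M"
  by (auto simp: maximal_cyclic_subgroups_def cyclic_subgroup_def dest: subgroup.one_closed)

lemma maximal_cyclic_subgroup_generator:
  assumes "M \<in> maximal_cyclic_subgroups G"
  obtains m where "m \<in> carrier G" "M = generate G {m}"
  using assms by (auto simp: maximal_cyclic_subgroups_def cyclic_subgroup_iff)

lemma subset_maximal_cyclic_subgroup_eq:
  assumes "M \<in> maximal_cyclic_subgroups G" and "N \<in> maximal_cyclic_subgroups G" and "M \<subseteq> N"
  shows "M = N"
  using assms by (auto simp: maximal_cyclic_subgroups_def)

lemma cyclic_subgroup_subset_maximal: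
  assumes "finite (carrier G)" and "cyclic_subgroup C G"
  obtains M where "M \<in> maximal_cyclic_subgroups G" "C \<subseteq> M"
proof -
  have "finite {N. cyclic_subgroup N G}"
    by (rule finite_subset[of _ "Pow (carrier G)"])
      (use assms in \<open>auto simp: cyclic_subgroup_def dest: subgroup.mem_carrier\<close>)
  then obtain M where "M \<in> {N. cyclic_subgroup N G}" "C \<subseteq> M"
    and "\<And>N. N \<in> {N. cyclic_subgroup N G} \<Longrightarrow> M \<subseteq> N \<Longrightarrow> M = N"
    using finite_has_maximal2[of "{N. cyclic_subgroup N G}" C] assms(2) by blast
  then show thesis
    using that[of M] by (auto simp: maximal_cyclic_subgroups_def)
qed

lemma mem_maximal_cyclic_subgroup:
  assumes "finite (carrier G)" and "x \<in> carrier G"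
  obtains M where "M \<in> maximal_cyclic_subgroups G" "x \<in> M"
proof -
  have "cyclic_subgroup (generate G {x}) G"
    using assms(2) by (auto simp: cyclic_subgroup_iff)
  then obtain M where "M \<in> maximal_cyclic_subgroups G" "generate G {x} \<subseteq> M"
    using cyclic_subgroup_subset_maximal assms(1) by blast
  then show thesis
    using that generate.incl[of x "{x}" G] by blast
qed

text \<open>The common cyclic subgroup witnessing adjacency may be enlarged to a maximal one, which turns
  adjacency to \<open>x\<close> into membership in the union of the maximal cyclic subgroups through \<open>x\<close>.\<close>

lemma common_cyclic_iff_common_maximal_cyclic:
  assumes "finite (carrier G)"
  shows "(\<exists>z \<in> carrier G. x \<in> generate G {z} \<and> y \<in> generate G {z}) \<longleftrightarrow>
    (\<exists>M \<in> maximal_cyclic_subgroups G. x \<in> M \<and> y \<in> M)"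
proof
  assume "\<exists>z \<in> carrier G. x \<in> generate G {z} \<and> y \<in> generate G {z}"
  then obtain z where z: "z \<in> carrier G" "x \<in> generate G {z}" "y \<in> generate G {z}" by blast
  then have "cyclic_subgroup (generate G {z}) G"
    by (auto simp: cyclic_subgroup_iff)
  then obtain M where "M \<in> maximal_cyclic_subgroups G" "generate G {z} \<subseteq> M"
    using cyclic_subgroup_subset_maximal assms by blast
  then show "\<exists>M \<in> maximal_cyclic_subgroups G. x \<in> M \<and> y \<in> M"
    using z by blast
next
  assume "\<exists>M \<in> maximal_cyclic_subgroups G. x \<in> M \<and> y \<in> M"
  then show "\<exists>z \<in> carrier G. x \<in> generate G {z} \<and> y \<in> generate G {z}"
    by (metis maximal_cyclic_subgroup_generator)
qed

lemma finite_Union_maximal_cyclic_subgroups: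
  assumes "finite (carrier G)"
  shows "finite (\<Union>{M \<in> maximal_cyclic_subgroups G. x \<in> M})"
  by (rule finite_subset[OF _ assms]) (use maximal_cyclic_subgroup_subset_carrier in blast)

text \<open>The union counts the neighbours of \<open>x\<close> together with \<open>x\<close> and \<open>\<one>\<close>. Adding 2 on the left, instead
  of subtracting it on the right, lets equal degrees be traded for equal cardinalities.\<close>

lemma out_degree_proper_enhanced_power_graph:
  assumes fin: "finite (carrier G)" and x: "x \<in> carrier G" "x \<noteq> \<one>"
  shows "out_degree (proper_enhanced_power_graph G) x + 2 =
    card (\<Union>{M \<in> maximal_cyclic_subgroups G. x \<in> M})" (is "_ = card ?U")
proof -
  let ?H = "proper_enhanced_power_graph G"
  let ?nbrs = "{y \<in> verts ?H. x \<rightarrow>\<^bsub>?H\<^esub> y}"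
  have nbrs: "?nbrs = ?U - {x, \<one>}"
    using x maximal_cyclic_subgroup_subset_carrier
    by (auto simp: verts_proper_enhanced_power_graph dominates_proper_enhanced_power_graph_iff
        common_cyclic_iff_common_maximal_cyclic[OF fin])
  have sub: "{x, \<one>} \<subseteq> ?U"
    using mem_maximal_cyclic_subgroup[OF fin x(1)] one_in_maximal_cyclic_subgroup by blast
  have "card ?nbrs + card {x, \<one>} = card ?U"
    unfolding nbrs
    using card_Diff_subset[OF _ sub] card_mono[OF finite_Union_maximal_cyclic_subgroups[OF fin] sub]
    by simp
  then show ?thesis
    using x(2) by (simp add: out_degree_graph[OF graph_proper_enhanced_power_graph[OF fin]])
qed

lemma regular_proper_enhanced_power_graph_iff:
  assumes "finite (carrier G)"
  shows "regular_graph (proper_enhanced_power_graph G) \<longleftrightarrow>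
    (\<forall>x \<in> carrier G - {\<one>}. \<forall>y \<in> carrier G - {\<one>}.
      card (\<Union>{M \<in> maximal_cyclic_subgroups G. x \<in> M}) =
      card (\<Union>{M \<in> maximal_cyclic_subgroups G. y \<in> M}))"
  unfolding regular_graph_def verts_proper_enhanced_power_graph
  by (intro ball_cong refl) (simp flip: out_degree_proper_enhanced_power_graph[OF assms])

lemma Union_maximal_cyclic_subgroups_generator:
  assumes "generate G {m} \<in> maximal_cyclic_subgroups G"
  shows "\<Union>{M \<in> maximal_cyclic_subgroups G. m \<in> M} = generate G {m}"
proof -
  have "M = generate G {m}" if "M \<in> maximal_cyclic_subgroups G" "m \<in> M" for M
  proof -
    have "subgroup M G"
      using that(1) by (simp add: maximal_cyclic_subgroups_def cyclic_subgroup_def)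
    then have "generate G {m} \<subseteq> M"
      using that(2) by (intro generate_subgroup_incl) auto
    then show ?thesis
      using subset_maximal_cyclic_subgroup_eq assms that(1) by blast
  qed
  moreover have "m \<in> generate G {m}"
    by (simp add: generate.incl)
  ultimately show ?thesis
    using assms by blast
qed

text \<open>If \<open>{\<one>}\<close> is maximal cyclic, then the group is trivial, so distinct maximal cyclic subgroups have
  non-identity generators.\<close>

lemma maximal_cyclic_subgroup_generator_nontrivial:
  assumes M: "M \<in> maximal_cyclic_subgroups G" and N: "N \<in> maximal_cyclic_subgroups G"
    and "M \<noteq> N"
  obtains m where "m \<in> carrier G - {\<one>}" "M = generate G {m}"
proof -
  obtain m where m: "m \<in> carrier G" "M = generate G {m}"
    using maximal_cyclic_subgroup_generator[OF M] .
  have "m \<noteq> \<one>"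
  proof
    assume "m = \<one>"
    then have "M \<subseteq> N"
      using m one_in_maximal_cyclic_subgroup[OF N] by (simp add: generate_one)
    then show False
      using subset_maximal_cyclic_subgroup_eq[OF M N] \<open>M \<noteq> N\<close> by blast
  qed
  then show thesis
    using m that by blast
qed

lemma regular_imp_maximal_cyclic_equal_card_trivial_inter:
  assumes fin: "finite (carrier G)"
    and reg: "regular_graph (proper_enhanced_power_graph G)"
    and M: "M \<in> maximal_cyclic_subgroups G" and N: "N \<in> maximal_cyclic_subgroups G"
    and "M \<noteq> N"
  shows "card M = card N" and "M \<inter> N = {\<one>}"
proof -
  let ?U = "\<lambda>x. \<Union>{M \<in> maximal_cyclic_subgroups G. x \<in> M}"
  have eq: "card (?U x) = card (?U y)" if "x \<in> carrier G - {\<one>}" "y \<in> carrier G - {\<one>}" for x y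
    using reg that unfolding regular_proper_enhanced_power_graph_iff[OF fin] by blast
  obtain m where m: "m \<in> carrier G - {\<one>}" "M = generate G {m}"
    using maximal_cyclic_subgroup_generator_nontrivial[OF M N \<open>M \<noteq> N\<close>] .
  obtain n where n: "n \<in> carrier G - {\<one>}" "N = generate G {n}"
    using maximal_cyclic_subgroup_generator_nontrivial[OF N M] \<open>M \<noteq> N\<close> by blast
  have Um: "?U m = M" and Un: "?U n = N"
    using Union_maximal_cyclic_subgroups_generator m n M N by auto
  show "card M = card N"
    using eq[OF m(1) n(1)] Um Un by simp
  show "M \<inter> N = {\<one>}"
  proof (rule ccontr)
    assume "M \<inter> N \<noteq> {\<one>}"
    then obtain x where x: "x \<in> M" "x \<in> N" "x \<noteq> \<one>"
      using one_in_maximal_cyclic_subgroup[OF M] one_in_maximal_cyclic_subgroup[OF N] by blast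
    have "\<not> N \<subseteq> M"
      using subset_maximal_cyclic_subgroup_eq[OF N M] \<open>M \<noteq> N\<close> by blast
    then have "M \<subset> ?U x"
      using x M N by blast
    then have "card M < card (?U x)"
      by (rule psubset_card_mono[OF finite_Union_maximal_cyclic_subgroups[OF fin]])
    moreover have "x \<in> carrier G - {\<one>}"
      using x maximal_cyclic_subgroup_subset_carrier[OF M] by blast
    ultimately show False
      using eq[OF _ m(1)] Um by force
  qed
qed

lemma maximal_cyclic_equal_card_trivial_inter_imp_regular:
  assumes fin: "finite (carrier G)"
    and part: "\<And>M N. \<lbrakk>M \<in> maximal_cyclic_subgroups G; N \<in> maximal_cyclic_subgroups G; M \<noteq> N\<rbrakk>
      \<Longrightarrow> card M = card N \<and> M \<inter> N = {\<one>}"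
  shows "regular_graph (proper_enhanced_power_graph G)"
proof -
  let ?U = "\<lambda>x. \<Union>{M \<in> maximal_cyclic_subgroups G. x \<in> M}"
  have U: "\<exists>M \<in> maximal_cyclic_subgroups G. ?U x = M" if x: "x \<in> carrier G - {\<one>}" for x
  proof -
    obtain M where M: "M \<in> maximal_cyclic_subgroups G" "x \<in> M"
      using mem_maximal_cyclic_subgroup[OF fin] x by blast
    then have "{N \<in> maximal_cyclic_subgroups G. x \<in> N} = {M}"
      using part[of _ M] x by blast
    then show ?thesis
      using M by auto
  qed
  have "card (?U x) = card (?U y)" if xy: "x \<in> carrier G - {\<one>}" "y \<in> carrier G - {\<one>}" for x y
  proof -
    obtain M N where "M \<in> maximal_cyclic_subgroups G" "?U x = M"
      and "N \<in> maximal_cyclic_subgroups G" "?U y = N"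
      using U[OF xy(1)] U[OF xy(2)] by blast
    then show ?thesis
      using part[of M N] by (cases "M = N") simp_all
  qed
  then show ?thesis
    unfolding regular_proper_enhanced_power_graph_iff[OF fin] by blast
qed

lemma maximal_cyclic_subgroup_of_cyclic_group:
  assumes "cyclic_group G" and M: "M \<in> maximal_cyclic_subgroups G"
  shows "M = carrier G"
proof -
  have "cyclic_subgroup (carrier G) G"
    using assms(1) subgroup_self by (simp add: cyclic_subgroup_def)
  then show ?thesis
    using M maximal_cyclic_subgroup_subset_carrier[OF M]
    by (auto simp: maximal_cyclic_subgroups_def)
qed

end

theorem theorem4p1:
  fixes G :: "('a, 'b) monoid_scheme"
  assumes "group G"
    and "finite (carrier G)"
  shows "regular_graph (proper_enhanced_power_graph G) \<longleftrightarrow>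
    cyclic_group G \<or>
    (\<forall>M\<^sub>i \<in> maximal_cyclic_subgroups G. \<forall>M\<^sub>j \<in> maximal_cyclic_subgroups G.
       M\<^sub>i \<noteq> M\<^sub>j \<longrightarrow> card M\<^sub>i = card M\<^sub>j \<and> M\<^sub>i \<inter> M\<^sub>j = {\<one>\<^bsub>G\<^esub>})"
    (is "?regular \<longleftrightarrow> ?cyclic \<or> ?partition")
proof -
  interpret group G by (rule assms(1))
  have "?regular \<longleftrightarrow> ?partition"
    using regular_imp_maximal_cyclic_equal_card_trivial_inter[OF assms(2)]
      maximal_cyclic_equal_card_trivial_inter_imp_regular[OF assms(2)] by blast
  moreover have "?cyclic \<Longrightarrow> ?partition"
    using maximal_cyclic_subgroup_of_cyclic_group by blast
  ultimately show ?thesis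
    by blast
qed

end
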